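(* Let $f:\mathbb{C}^n\to\mathbb{R}$ be real-analytic (as a function on $\mathbb{R}^{2n}$). Then at every point of $\mathbb{C}^n$ the Hessian matrices of $f$ satisfy $$\mathcal{H}_{\mathbf{r}\mathbf{r}}=\mathsf{J}^H\,\mathcal{H}^{\mathbb{C}}_{\mathbf{c}\mathbf{c}}\,\mathsf{J},$$ and for every $\Delta\mathbf{z}=\Delta\mathbf{x}+j\,\Delta\mathbf{y}\in\mathbb{C}^n$ (with $\Delta\mathbf{x},\Delta\mathbf{y}\in\mathbb{R}^n$), writing $\Delta\mathbf{r}=\begin{pmatrix}\Delta\mathbf{x}\\ \Delta\mathbf{y}\end{pmatrix}$ and $\Delta\mathbf{c}=\begin{pmatrix}\Delta\mathbf{z}\\ \overline{\Delta\mathbf{z}}\end{pmatrix}$, one has $$\tfrac12\Delta\mathbf{r}^T\mathcal{H}_{\mathbf{r}\mathbf{r}}\Delta\mathbf{r}=\tfrac12\Delta\mathbf{c}^T\mathcal{H}^{\mathbb{R}}_{\mathbf{c}\mathbf{c}}\Delta\mathbf{c}=\tfrac12\Delta\mathbf{c}^H\mathcal{H}^{\mathbb{C}}_{\mathbf{c}\mathbf{c}}\Delta\mathbf{c}=\mathrm{Re}\left\{\Delta\mathbf{z}^H\mathcal{H}_{\mathbf{z}\mathbf{z}}\Delta\mathbf{z}+\Delta\mathbf{z}^H\mathcal{H}_{\bar{\mathbf{z}}\mathbf{z}}\overline{\Delta\mathbf{z}}\right\}.$$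
   Context: Here $j=\sqrt{-1}$, a bar is entrywise complex conjugation, and ${}^H$ is conjugate transpose. Write $\mathbf{z}=\mathbf{x}+j\mathbf{y}\in\mathbb{C}^n$, $\mathbf{r}=(\mathbf{x}^T,\mathbf{y}^T)^T\in\mathbb{R}^{2n}$, and $\mathbf{c}=(\mathbf{z}^T,\bar{\mathbf{z}}^T)^T$. Define the row operators $\frac{\partial}{\partial\mathbf{z}}=\frac12\left(\frac{\partial}{\partial\mathbf{x}}-j\frac{\partial}{\partial\mathbf{y}}\right)$, $\frac{\partial}{\partial\bar{\mathbf{z}}}=\frac12\left(\frac{\partial}{\partial\mathbf{x}}+j\frac{\partial}{\partial\mathbf{y}}\right)$ (each of length $n$), $\frac{\partial}{\partial\mathbf{c}}=\left(\frac{\partial}{\partial\mathbf{z}},\frac{\partial}{\partial\bar{\mathbf{z}}}\right)$, and $\frac{\partial}{\partial\mathbf{r}}=\left(\frac{\partial}{\partial\mathbf{x}},\frac{\partial}{\partial\mathbf{y}}\right)$ (each of length $2n$). Applied to a column-vector-valued function $F$, such an operator gives the matrix whose $(k,l)$ entry is the $l$-th component operator applied to $F_k$. Define $$\mathcal{H}_{\mathbf{r}\mathbf{r}}=\frac{\partial}{\partial\mathbf{r}}\left(\frac{\partial f}{\partial\mathbf{r}}\right)^T,\quad \mathcal{H}^{\mathbb{C}}_{\mathbf{c}\mathbf{c}}=\frac{\partial}{\partial\mathbf{c}}\left(\frac{\partial f}{\partial\mathbf{c}}\right)^H,\quad \mathcal{H}^{\mathbb{R}}_{\mathbf{c}\mathbf{c}}=\frac{\partial}{\partial\mathbf{c}}\left(\frac{\partial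 f}{\partial\mathbf{c}}\right)^T,\quad \mathcal{H}_{\mathbf{z}\mathbf{z}}=\frac{\partial}{\partial\mathbf{z}}\left(\frac{\partial f}{\partial\mathbf{z}}\right)^H,\quad \mathcal{H}_{\bar{\mathbf{z}}\mathbf{z}}=\frac{\partial}{\partial\bar{\mathbf{z}}}\left(\frac{\partial f}{\partial\mathbf{z}}\right)^H,$$ and the $2n\times 2n$ matrix $\mathsf{J}=\begin{pmatrix}I&jI\\ I&-jI\end{pmatrix}$, with $I$ the $n\times n$ identity. *)

theory Defs
  imports "HOL-Analysis.Analysis"
begin

text \<open>
  Vectors and matrices of size \<open>2n\<close> are indexed by the sum type \<open>'n + 'n\<close>: \<open>Inl\<close> selects the
  first half, \<open>Inr\<close> the second.
\<close>

definition stack :: "'a ^ 'n \<Rightarrow> 'a ^ 'n \<Rightarrow> 'a ^ ('n + 'n)" where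
  "stack u v = (\<chi> k. case k of Inl i \<Rightarrow> u $ i | Inr i \<Rightarrow> v $ i)"

definition block_matrix ::
    "'a ^ 'n ^ 'n \<Rightarrow> 'a ^ 'n ^ 'n \<Rightarrow> 'a ^ 'n ^ 'n \<Rightarrow> 'a ^ 'n ^ 'n \<Rightarrow> 'a ^ ('n + 'n) ^ ('n + 'n)" where
  "block_matrix A B C D = (\<chi> k. case k of Inl i \<Rightarrow> stack (A $ i) (B $ i) | Inr i \<Rightarrow> stack (C $ i) (D $ i))"

definition cnj_vec :: "complex ^ 'n \<Rightarrow> complex ^ 'n" where
  "cnj_vec v = (\<chi> i. cnj (v $ i))"

definition conj_transpose :: "complex ^ 'n ^ 'm \<Rightarrow> complex ^ 'm ^ 'n" where
  "conj_transpose A = transpose (map_matrix cnj A)"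

definition complex_vec :: "real ^ 'n \<Rightarrow> real ^ 'n \<Rightarrow> complex ^ 'n" where
  "complex_vec x y = (\<chi> i. Complex (x $ i) (y $ i))"

text \<open>
  Around every point the function is the sum of a multivariate power series; the multi-indices are
  all functions \<open>'m \<Rightarrow> nat\<close>, since \<open>'m\<close> is finite. The sum \<open>has_sum\<close> is unconditional, that is,
  absolute.
\<close>

definition real_analytic :: "(real ^ 'm \<Rightarrow> real) \<Rightarrow> bool" where
  "real_analytic g \<longleftrightarrow>
     (\<forall>a. \<exists>coef :: ('m \<Rightarrow> nat) \<Rightarrow> real. \<exists>\<epsilon>>0. \<forall>r\<in>ball a \<epsilon>.
        ((\<lambda>m. coef m * (\<Prod>i\<in>UNIV. (r $ i - a $ i) ^ m i)) has_sum g r) UNIV)"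

definition real_analytic_complex :: "(complex ^ 'n \<Rightarrow> real) \<Rightarrow> bool" where
  "real_analytic_complex f \<longleftrightarrow> real_analytic (\<lambda>r. f (complex_vec (\<chi> i. r $ Inl i) (\<chi> i. r $ Inr i)))"

definition partial_x :: "'n \<Rightarrow> (complex ^ 'n \<Rightarrow> 'b::real_normed_vector) \<Rightarrow> complex ^ 'n \<Rightarrow> 'b" where
  "partial_x l F z = vector_derivative (\<lambda>t. F (z + axis l (complex_of_real t))) (at 0)"

definition partial_y :: "'n \<Rightarrow> (complex ^ 'n \<Rightarrow> 'b::real_normed_vector) \<Rightarrow> complex ^ 'n \<Rightarrow> 'b" where
  "partial_y l F z = vector_derivative (\<lambda>t. F (z + axis l (\<i> * complex_of_real t))) (at 0)"

definition partial_z :: "'n \<Rightarrow> (complex ^ 'n \<Rightarrow> complex) \<Rightarrow> complex ^ 'n \<Rightarrow> complex" where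
  "partial_z l F z = 1/2 * (partial_x l F z - \<i> * partial_y l F z)"

definition partial_zbar :: "'n \<Rightarrow> (complex ^ 'n \<Rightarrow> complex) \<Rightarrow> complex ^ 'n \<Rightarrow> complex" where
  "partial_zbar l F z = 1/2 * (partial_x l F z + \<i> * partial_y l F z)"

definition partial_r :: "'n + 'n \<Rightarrow> (complex ^ 'n \<Rightarrow> 'b::real_normed_vector) \<Rightarrow> complex ^ 'n \<Rightarrow> 'b" where
  "partial_r = case_sum partial_x partial_y"

definition partial_c :: "'n + 'n \<Rightarrow> (complex ^ 'n \<Rightarrow> complex) \<Rightarrow> complex ^ 'n \<Rightarrow> complex" where
  "partial_c = case_sum partial_z partial_zbar"

text \<open>
  A row operator is the family \<open>D\<close> of its component operators. The type \<open>'b ^ 'm\<close> does not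
  distinguish rows from columns, so transposing a gradient is the identity and its conjugate
  transpose is \<^const>\<open>cnj_vec\<close>.
\<close>

definition row_gradient ::
    "('m \<Rightarrow> (complex ^ 'n \<Rightarrow> 'b) \<Rightarrow> complex ^ 'n \<Rightarrow> 'b) \<Rightarrow> (complex ^ 'n \<Rightarrow> 'b) \<Rightarrow> complex ^ 'n \<Rightarrow> 'b ^ 'm" where
  "row_gradient D g z = (\<chi> l. D l g z)"

definition jacobian ::
    "('m \<Rightarrow> (complex ^ 'n \<Rightarrow> 'b) \<Rightarrow> complex ^ 'n \<Rightarrow> 'b) \<Rightarrow> (complex ^ 'n \<Rightarrow> 'b ^ 'k) \<Rightarrow> complex ^ 'n \<Rightarrow> 'b ^ 'm ^ 'k" where
  "jacobian D F z = (\<chi> k l. D l (\<lambda>w. F w $ k) z)"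

definition hessian_rr :: "(complex ^ 'n \<Rightarrow> real) \<Rightarrow> complex ^ 'n \<Rightarrow> real ^ ('n + 'n) ^ ('n + 'n)" where
  "hessian_rr f = jacobian partial_r (row_gradient partial_r f)"

definition hessian_C_cc :: "(complex ^ 'n \<Rightarrow> real) \<Rightarrow> complex ^ 'n \<Rightarrow> complex ^ ('n + 'n) ^ ('n + 'n)" where
  "hessian_C_cc f =
     jacobian partial_c (\<lambda>w. cnj_vec (row_gradient partial_c (\<lambda>v. complex_of_real (f v)) w))"

definition hessian_R_cc :: "(complex ^ 'n \<Rightarrow> real) \<Rightarrow> complex ^ 'n \<Rightarrow> complex ^ ('n + 'n) ^ ('n + 'n)" where
  "hessian_R_cc f = jacobian partial_c (row_gradient partial_c (\<lambda>v. complex_of_real (f v)))"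

definition hessian_zz :: "(complex ^ 'n \<Rightarrow> real) \<Rightarrow> complex ^ 'n \<Rightarrow> complex ^ 'n ^ 'n" where
  "hessian_zz f =
     jacobian partial_z (\<lambda>w. cnj_vec (row_gradient partial_z (\<lambda>v. complex_of_real (f v)) w))"

definition hessian_zbarz :: "(complex ^ 'n \<Rightarrow> real) \<Rightarrow> complex ^ 'n \<Rightarrow> complex ^ 'n ^ 'n" where
  "hessian_zbarz f =
     jacobian partial_zbar (\<lambda>w. cnj_vec (row_gradient partial_z (\<lambda>v. complex_of_real (f v)) w))"

definition J_mat :: "complex ^ ('n::finite + 'n) ^ ('n + 'n)" where
  "J_mat = block_matrix (mat 1) (mat \<i>) (mat 1) (mat (- \<i>))"

end

(* A convergent multivariate power series, viewed as a complex power series in one of its variables,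
   converges uniformly on a closed disc, so by Weierstrass it may be differentiated termwise; hence
   partial derivatives of real-analytic functions exist and are again real-analytic. This gives the
   existence of all second partials, after which every complex Hessian entry is a fixed linear
   combination of four entries of the real Hessian and all identities hold entrywise. The symmetry
   of the Hessian plays no role: that f is real gives cnj (df/dz) = df/dzbar, which relates the
   R-form to the C-form and makes the lower half of the C-form the conjugate of the upper half. *)

theory Submission
  imports Defs "HOL-Complex_Analysis.Cauchy_Integral_Formula"
begin

section \<open>Termwise differentiation of multivariate power series\<close>

text \<open>The M-test makes the finite partial sums converge uniformly on the closed disc, so their
  derivatives converge to the derivative of the limit inside. The index set is arbitrary and
  \<open>p\<close> only reads off an exponent: a series over all multi-indices can then be viewed as
  a series in one variable without grouping equal powers.\<close>

lemma has_sum_power_derivative: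
  fixes c :: "'b \<Rightarrow> complex" and p :: "'b \<Rightarrow> nat"
  assumes "0 < s" and summable: "(\<lambda>x. norm (c x) * s ^ p x) summable_on X"
  shows "\<exists>G'. \<forall>w\<in>ball 0 s.
    ((\<lambda>w. \<Sum>\<^sub>\<infinity>x\<in>X. c x * w ^ p x) has_field_derivative G' w) (at w) \<and>
    ((\<lambda>x. c x * (of_nat (p x) * w ^ (p x - 1))) has_sum G' w) X"
proof -
  have limit: "uniform_limit (cball 0 s) (\<lambda>Y w. \<Sum>x\<in>Y. c x * w ^ p x)
      (\<lambda>w. \<Sum>\<^sub>\<infinity>x\<in>X. c x * w ^ p x) (finite_subsets_at_top X)"
    using summable
    by (intro Weierstrass_m_test_general[where M = "\<lambda>x. norm (c x) * s ^ p x"])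
       (auto simp: norm_mult norm_power intro!: mult_left_mono power_mono)
  have deriv: "\<forall>\<^sub>F Y in finite_subsets_at_top X. continuous_on (cball 0 s) (\<lambda>w. \<Sum>x\<in>Y. c x * w ^ p x) \<and>
      (\<forall>w\<in>ball 0 s. ((\<lambda>w. \<Sum>x\<in>Y. c x * w ^ p x) has_field_derivative
        (\<Sum>x\<in>Y. c x * (of_nat (p x) * w ^ (p x - 1)))) (at w))"
    by (intro always_eventually allI conjI ballI continuous_intros)
       (auto intro!: derivative_eq_intros sum.cong)
  obtain G' where "\<And>w. w \<in> ball 0 s \<Longrightarrow>
      ((\<lambda>w. \<Sum>\<^sub>\<infinity>x\<in>X. c x * w ^ p x) has_field_derivative G' w) (at w) \<and>
      ((\<lambda>Y. \<Sum>x\<in>Y. c x * (of_nat (p x) * w ^ (p x - 1))) \<longlongrightarrow> G' w) (finite_subsets_at_top X)"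
    using has_complex_derivative_uniform_limit[OF deriv limit finite_subsets_at_top_neq_bot \<open>0 < s\<close>] by blast
  then show ?thesis
    unfolding has_sum_def by blast
qed

text \<open>Freezing all coordinates but the \<open>k\<close>-th turns the series into one of the
  form treated above. Absolute convergence at one corner of a cube around \<open>a\<close> provides
  the majorant for every point of the cube. The radius may shrink, which is harmless for
  analyticity.\<close>

lemma multivariate_power_series_partial_derivative:
  fixes g :: "real ^ 'm \<Rightarrow> real" and coef :: "('m \<Rightarrow> nat) \<Rightarrow> real"
  assumes "0 < \<epsilon>"
    and sums: "\<And>r. r \<in> ball a \<epsilon> \<Longrightarrow>
      ((\<lambda>m. coef m * (\<Prod>i\<in>UNIV. (r $ i - a $ i) ^ m i)) has_sum g r) UNIV"
  shows "\<exists>\<delta>>0. \<forall>r\<in>ball a \<delta>. \<exists>D. ((\<lambda>t. g (r + axis k t)) has_real_derivative D) (at 0) \<and>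
    ((\<lambda>m. real (Suc (m k)) * coef (m(k := Suc (m k))) * (\<Prod>i\<in>UNIV. (r $ i - a $ i) ^ m i))
      has_sum D) UNIV"
proof -
  \<comment> \<open>With this \<open>s\<close> the cube of half-side \<open>s\<close> around
    \<open>a\<close> has l1-radius \<epsilon>/2, so it lies inside the \<epsilon>-ball.\<close>
  define s where "s = \<epsilon> / (2 * real CARD('m))"
  have "0 < s"
    using \<open>0 < \<epsilon>\<close> by (simp add: s_def)
  have in_ball: "r \<in> ball a \<epsilon>" if "\<And>i. \<bar>r $ i - a $ i\<bar> \<le> s" for r :: "real ^ 'm"
  proof -
    have "dist a r \<le> (\<Sum>i\<in>(UNIV::'m set). \<bar>(a - r) $ i\<bar>)"
      unfolding dist_norm by (rule norm_le_l1_cart)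
    also have "\<dots> \<le> (\<Sum>i\<in>(UNIV::'m set). s)"
      using that by (intro sum_mono) (simp add: abs_minus_commute)
    also have "\<dots> < \<epsilon>"
      using \<open>0 < \<epsilon>\<close> by (simp add: s_def)
    finally show ?thesis by simp
  qed
  have split: "(\<Prod>i\<in>UNIV. h i) = (\<Prod>i\<in>UNIV - {k}. h i) * h k" for h :: "'m \<Rightarrow> real"
    by (subst prod.remove[of UNIV k]) auto
  have abs_sum: "(\<lambda>m. \<bar>coef m\<bar> * (\<Prod>i\<in>UNIV. s ^ m i)) summable_on UNIV"
  proof -
    have "(\<lambda>m. coef m * (\<Prod>i\<in>UNIV. s ^ m i)) summable_on UNIV"
      \<comment> \<open>At the corner where every coordinate exceeds that of \<open>a\<close> by
        \<open>s\<close>, the series itself has the terms of the majorant up to sign.\<close>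
      using sums[OF in_ball, of "\<chi> i. a $ i + s"] \<open>0 < s\<close> by (auto intro: has_sum_imp_summable)
    then have "(\<lambda>m. norm (coef m * (\<Prod>i\<in>UNIV. s ^ m i))) summable_on UNIV"
      by (rule summable_on_iff_abs_summable_on_real[THEN iffD1])
    then show ?thesis
      using \<open>0 < s\<close> by (simp add: abs_mult abs_prod power_abs)
  qed
  show ?thesis
  proof (rule exI[of _ s], intro conjI ballI \<open>0 < s\<close>)
    fix r assume r: "r \<in> ball a s"
    define u where "u i = r $ i - a $ i" for i
    have u: "\<bar>u i\<bar> < s" for i
      using r component_le_norm_cart[of "r - a" i] by (simp add: u_def dist_norm norm_minus_commute)
    define c where "c m = coef m * (\<Prod>i\<in>UNIV - {k}. u i ^ m i)" for m
    have "(\<lambda>m. norm (complex_of_real (c m)) * s ^ m k) summable_on UNIV"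
    proof (rule summable_on_comparison_test[OF abs_sum])
      fix m
      have "norm (complex_of_real (c m)) * s ^ m k = \<bar>coef m\<bar> * ((\<Prod>i\<in>UNIV - {k}. \<bar>u i\<bar> ^ m i) * s ^ m k)"
        unfolding norm_of_real c_def by (simp add: abs_mult abs_prod power_abs)
      also have "\<dots> \<le> \<bar>coef m\<bar> * ((\<Prod>i\<in>UNIV - {k}. s ^ m i) * s ^ m k)"
        using u \<open>0 < s\<close>
        by (intro mult_left_mono mult_right_mono prod_mono) (auto intro!: power_mono intro: less_imp_le)
      also have "\<dots> = \<bar>coef m\<bar> * (\<Prod>i\<in>UNIV. s ^ m i)"
        by (simp only: split[of "\<lambda>i. s ^ m i"])
      finally show "norm (complex_of_real (c m)) * s ^ m k \<le> \<bar>coef m\<bar> * (\<Prod>i\<in>UNIV. s ^ m i)" .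
    qed (use \<open>0 < s\<close> in auto)
    from has_sum_power_derivative[OF \<open>0 < s\<close> this] obtain G' where
      deriv: "\<forall>w\<in>ball 0 s. ((\<lambda>w. \<Sum>\<^sub>\<infinity>m. complex_of_real (c m) * w ^ m k) has_field_derivative G' w) (at w)" and
      sum': "\<forall>w\<in>ball 0 s. ((\<lambda>m. complex_of_real (c m) * (of_nat (m k) * w ^ (m k - 1))) has_sum G' w) UNIV"
      by blast
    define G where "G w = (\<Sum>\<^sub>\<infinity>m. complex_of_real (c m) * w ^ m k)" for w
    have uk: "complex_of_real (u k) \<in> ball 0 s"
      using u[of k] by simp
    have G: "G (complex_of_real (u k + t)) = complex_of_real (g (r + axis k t))" if "\<bar>u k + t\<bar> < s" for t
    \<comment> \<open>On the real axis the complexified one-variable series reproduces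
      \<open>g\<close> along the \<open>k\<close>-th coordinate line through
      \<open>r\<close>.\<close>
    proof -
      have coord: "(r + axis k t) $ i - a $ i = (if i = k then u k + t else u i)" for i
        by (simp add: u_def axis_def)
      have "r + axis k t \<in> ball a \<epsilon>"
        using u that by (intro in_ball) (simp only: coord, auto intro: less_imp_le)
      note sums[OF this]
      moreover have "coef m * (\<Prod>i\<in>UNIV. ((r + axis k t) $ i - a $ i) ^ m i) = c m * (u k + t) ^ m k" for m
        unfolding coord split c_def by simp
      ultimately have "((\<lambda>m. c m * (u k + t) ^ m k) has_sum g (r + axis k t)) UNIV"
        by simp
      from has_sum_of_real[OF this, where 'a = complex] show ?thesis
        unfolding G_def by (auto intro!: infsumI)
    qed
    have "((\<lambda>t. Re (G (complex_of_real (u k + t)))) has_real_derivative Re (G' (u k))) (at 0)"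
    proof -
      have "((\<lambda>x. G (complex_of_real x)) has_vector_derivative G' (u k)) (at (u k))"
        using bspec[OF deriv uk] unfolding G_def by (rule has_vector_derivative_real_field)
      then have "((\<lambda>x. Re (G (complex_of_real x))) has_real_derivative Re (G' (u k))) (at (u k))"
        unfolding has_real_derivative_iff_has_vector_derivative
        by (rule bounded_linear.has_vector_derivative[OF bounded_linear_Re])
      then show ?thesis
        using DERIV_shift[of "\<lambda>x. Re (G (complex_of_real x))" "Re (G' (u k))" 0 "u k"]
        by (simp add: add.commute)
    qed
    \<comment> \<open>The interval below consists of the \<open>t\<close> with \<bar>u k + t\<bar> <
      s, where \<open>G\<close> is known to agree with \<open>g\<close>; it contains 0.\<close>
    then have D: "((\<lambda>t. g (r + axis k t)) has_real_derivative Re (G' (u k))) (at 0)"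
      by (rule has_field_derivative_transform_within_open[where S = "{- s - u k<..<s - u k}"])
         (use u[of k] G in auto)
    have "((\<lambda>m. c m * (real (m k) * u k ^ (m k - 1))) has_sum Re (G' (u k))) UNIV"
      using has_sum_Re[OF bspec[OF sum' uk]] by simp
    \<comment> \<open>Terms with \<open>m k = 0\<close> vanish through the factor
      \<open>m k\<close>. Removing them first makes lowering the \<open>k\<close>-th exponent a
      bijection onto all multi-indices, despite truncated subtraction.\<close>
    also have "?this \<longleftrightarrow> ((\<lambda>m. c m * (real (m k) * u k ^ (m k - 1))) has_sum Re (G' (u k))) {m. m k \<noteq> 0}"
      by (rule has_sum_cong_neutral) auto
    also have "\<dots> \<longleftrightarrow> ((\<lambda>m. real (Suc (m k)) * coef (m(k := Suc (m k))) * (\<Prod>i\<in>UNIV. u i ^ m i))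
        has_sum Re (G' (u k))) UNIV"
      by (rule has_sum_reindex_bij_witness[where i = "\<lambda>m. m(k := Suc (m k))" and j = "\<lambda>m. m(k := m k - 1)"])
         (auto simp: c_def split)
    finally show "\<exists>D. ((\<lambda>t. g (r + axis k t)) has_real_derivative D) (at 0) \<and>
      ((\<lambda>m. real (Suc (m k)) * coef (m(k := Suc (m k))) * (\<Prod>i\<in>UNIV. (r $ i - a $ i) ^ m i))
        has_sum D) UNIV"
      using D by (auto simp: u_def)
  qed
qed

text \<open>Each centre yields its own local series; uniqueness of derivatives makes all of them sum
  to one global function, hence the definition of \<open>g'\<close> by description.\<close>

lemma real_analytic_partial_derivative:
  fixes g :: "real ^ 'm \<Rightarrow> real"
  assumes "real_analytic g"
  obtains g' where "real_analytic g'"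
    and "\<And>r. ((\<lambda>t. g (r + axis k t)) has_real_derivative g' r) (at 0)"
proof -
  define g' where "g' r = (THE D. ((\<lambda>t. g (r + axis k t)) has_real_derivative D) (at 0))" for r
  have g'_eq: "g' r = D" if "((\<lambda>t. g (r + axis k t)) has_real_derivative D) (at 0)" for r D
    unfolding g'_def using that DERIV_unique by blast
  have local: "\<exists>coef' \<delta>. 0 < \<delta> \<and> (\<forall>r\<in>ball a \<delta>. ((\<lambda>t. g (r + axis k t)) has_real_derivative g' r) (at 0) \<and>
      ((\<lambda>m. coef' m * (\<Prod>i\<in>UNIV. (r $ i - a $ i) ^ m i)) has_sum g' r) UNIV)" for a
  proof -
    obtain coef \<epsilon> where "0 < \<epsilon>" and
      "\<And>r. r \<in> ball a \<epsilon> \<Longrightarrow> ((\<lambda>m. coef m * (\<Prod>i\<in>UNIV. (r $ i - a $ i) ^ m i)) has_sum g r) UNIV"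
      using assms unfolding real_analytic_def by meson
    from multivariate_power_series_partial_derivative[OF this, of k]
    obtain \<delta> where "0 < \<delta>" and
      "\<forall>r\<in>ball a \<delta>. \<exists>D. ((\<lambda>t. g (r + axis k t)) has_real_derivative D) (at 0) \<and>
        ((\<lambda>m. real (Suc (m k)) * coef (m(k := Suc (m k))) * (\<Prod>i\<in>UNIV. (r $ i - a $ i) ^ m i))
          has_sum D) UNIV"
      by blast
    with g'_eq show ?thesis
      by (intro exI[of _ "\<lambda>m. real (Suc (m k)) * coef (m(k := Suc (m k)))"] exI[of _ \<delta>]) auto
  qed
  show ?thesis
  proof
    show "real_analytic g'"
      unfolding real_analytic_def using local by meson
    show "((\<lambda>t. g (r + axis k t)) has_real_derivative g' r) (at 0)" for r
      using local[of r] by auto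
  qed
qed

section \<open>Transfer of partial derivatives to complex n-space\<close>

lemma complex_vec_Re_Im: "complex_vec (\<chi> i. Re (z $ i)) (\<chi> i. Im (z $ i)) = z"
  by (simp add: complex_vec_def vec_eq_iff complex_eq_iff)

text \<open>Puts the x- and y-partials in one form, so that a single argument covers both.\<close>

definition real_direction :: "'n + 'n \<Rightarrow> real \<Rightarrow> complex ^ 'n" where
  "real_direction k t =
     (case k of Inl l \<Rightarrow> axis l (complex_of_real t) | Inr l \<Rightarrow> axis l (\<i> * complex_of_real t))"

lemma partial_r_eq: "partial_r k F z = vector_derivative (\<lambda>t. F (z + real_direction k t)) (at 0)"
  by (cases k) (simp_all add: partial_r_def partial_x_def partial_y_def real_direction_def)

text \<open>The identification \<open>C\<close> of real 2n-space with complex n-space carries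
  coordinate lines to the lines of \<open>real_direction\<close>, so the result for real-analytic
  functions carries over.\<close>

lemma real_analytic_complex_partial_r:
  fixes f :: "complex ^ 'n \<Rightarrow> real"
  assumes "real_analytic_complex f"
  shows "real_analytic_complex (partial_r k f)"
    and "((\<lambda>t. f (z + real_direction k t)) has_real_derivative partial_r k f z) (at 0)"
proof -
  define C :: "real ^ ('n + 'n) \<Rightarrow> complex ^ 'n"
    where "C r = complex_vec (\<chi> i. r $ Inl i) (\<chi> i. r $ Inr i)" for r
  have C_axis: "C (r + axis k t) = C r + real_direction k t" for r t
    by (cases k)
       (auto simp: C_def complex_vec_def real_direction_def vec_eq_iff axis_def complex_eq_iff)
  have "real_analytic (\<lambda>r. f (C r))"
    using assms by (simp add: real_analytic_complex_def C_def)
  then obtain g' where g': "real_analytic g'"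
    and "\<And>r. ((\<lambda>t. f (C (r + axis k t))) has_real_derivative g' r) (at 0)"
    using real_analytic_partial_derivative[of "\<lambda>r. f (C r)" k] by blast
  then have der: "((\<lambda>t. f (C r + real_direction k t)) has_real_derivative g' r) (at 0)" for r
    by (simp add: C_axis)
  have partial: "partial_r k f (C r) = g' r" for r
    unfolding partial_r_eq
    using der[of r] by (simp add: vector_derivative_at has_real_derivative_iff_has_vector_derivative)
  show "real_analytic_complex (partial_r k f)"
    using g' partial by (simp add: real_analytic_complex_def C_def)
  \<comment> \<open>Surjectivity of \<open>C\<close>: what holds at all points \<open>C r\<close>
    holds at every \<open>z\<close>.\<close>
  have "C (stack (\<chi> i. Re (z $ i)) (\<chi> i. Im (z $ i))) = z"
    by (simp add: C_def stack_def complex_vec_Re_Im)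
  then show "((\<lambda>t. f (z + real_direction k t)) has_real_derivative partial_r k f z) (at 0)"
    using der partial by metis
qed

text \<open>Where no derivative exists \<open>vector_derivative\<close> is an arbitrary value, so
  linearity needs differentiability, here supplied by analyticity. Conjugated Wirtinger gradients
  have exactly this shape.\<close>

lemma partial_r_complex_combination:
  fixes u v :: "complex ^ 'n \<Rightarrow> real"
  assumes "real_analytic_complex u" "real_analytic_complex v"
  shows "partial_r k (\<lambda>w. \<alpha> * complex_of_real (u w) + \<beta> * complex_of_real (v w)) z
    = \<alpha> * complex_of_real (partial_r k u z) + \<beta> * complex_of_real (partial_r k v z)"
  unfolding partial_r_eq[of k "\<lambda>w. \<alpha> * complex_of_real (u w) + \<beta> * complex_of_real (v w)"]
  by (intro vector_derivative_at has_vector_derivative_add has_vector_derivative_mult_right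
      has_vector_derivative_of_real real_analytic_complex_partial_r assms)

section \<open>Complex Hessian entries in terms of the real Hessian\<close>

text \<open>The coefficient of the y-partial in twice the Wirtinger operator. Together with
  \<open>wirtinger_index\<close> it lets one formula describe all four blocks of a complex
  Hessian.\<close>

definition wirtinger_sign :: "'n + 'n \<Rightarrow> complex" where
  "wirtinger_sign k = (case k of Inl _ \<Rightarrow> - \<i> | Inr _ \<Rightarrow> \<i>)"

definition wirtinger_index :: "'n + 'n \<Rightarrow> 'n" where
  "wirtinger_index k = (case k of Inl i \<Rightarrow> i | Inr i \<Rightarrow> i)"

lemma partial_c_eq:
  "partial_c k F z = (partial_r (Inl (wirtinger_index k)) F z
     + wirtinger_sign k * partial_r (Inr (wirtinger_index k)) F z) / 2"
  by (cases k) (simp_all add: partial_c_def partial_z_def partial_zbar_def partial_r_def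
      wirtinger_sign_def wirtinger_index_def)

lemma partial_c_complex_combination:
  fixes u v :: "complex ^ 'n \<Rightarrow> real"
  assumes "real_analytic_complex u" "real_analytic_complex v"
  shows "partial_c k (\<lambda>w. \<alpha> * complex_of_real (u w) + \<beta> * complex_of_real (v w)) z
    = (\<alpha> * partial_r (Inl (wirtinger_index k)) u z + \<beta> * partial_r (Inl (wirtinger_index k)) v z
      + wirtinger_sign k * (\<alpha> * partial_r (Inr (wirtinger_index k)) u z
        + \<beta> * partial_r (Inr (wirtinger_index k)) v z)) / 2"
  by (simp add: partial_c_eq partial_r_complex_combination[OF assms])

lemma partial_c_of_real:
  assumes "real_analytic_complex f"
  shows "partial_c k (\<lambda>w. complex_of_real (f w)) z
    = 1/2 * complex_of_real (partial_r (Inl (wirtinger_index k)) f z)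
      + wirtinger_sign k / 2 * complex_of_real (partial_r (Inr (wirtinger_index k)) f z)"
  using partial_c_complex_combination[OF assms assms, of k 1 0 z] by (simp add: add_divide_distrib)

lemma cnj_wirtinger_sign: "cnj (wirtinger_sign k) = - wirtinger_sign k"
  by (cases k) (simp_all add: wirtinger_sign_def)

lemma hessian_rr_nth: "hessian_rr f z $ k $ l = partial_r l (partial_r k f) z"
  by (simp add: hessian_rr_def jacobian_def row_gradient_def)

text \<open>The sign belonging to \<open>k\<close> is purely imaginary, so conjugating the gradient
  negates it; the outer operator comes after the conjugation, so the sign belonging to
  \<open>l\<close> stays.\<close>

lemma hessian_C_cc_nth:
  fixes f :: "complex ^ 'n \<Rightarrow> real" and z :: "complex ^ 'n"
  assumes "real_analytic_complex f"
  defines "H \<equiv> hessian_rr f z"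
  shows "hessian_C_cc f z $ k $ l =
    (H $ Inl (wirtinger_index k) $ Inl (wirtinger_index l)
      - wirtinger_sign k * H $ Inr (wirtinger_index k) $ Inl (wirtinger_index l)
      + wirtinger_sign l * (H $ Inl (wirtinger_index k) $ Inr (wirtinger_index l)
      - wirtinger_sign k * H $ Inr (wirtinger_index k) $ Inr (wirtinger_index l))) / 4"
proof -
  have "cnj (partial_c k (\<lambda>w. complex_of_real (f w)) w)
    = 1/2 * complex_of_real (partial_r (Inl (wirtinger_index k)) f w)
      + (- wirtinger_sign k / 2) * complex_of_real (partial_r (Inr (wirtinger_index k)) f w)" for w
    by (simp add: partial_c_of_real assms(1) cnj_wirtinger_sign)
  then have "hessian_C_cc f z $ k $ l = partial_c l (\<lambda>w.
      1/2 * complex_of_real (partial_r (Inl (wirtinger_index k)) f w)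
      + (- wirtinger_sign k / 2) * complex_of_real (partial_r (Inr (wirtinger_index k)) f w)) z"
    by (simp add: hessian_C_cc_def jacobian_def row_gradient_def cnj_vec_def)
  also have "\<dots> = (H $ Inl (wirtinger_index k) $ Inl (wirtinger_index l)
      - wirtinger_sign k * H $ Inr (wirtinger_index k) $ Inl (wirtinger_index l)
      + wirtinger_sign l * (H $ Inl (wirtinger_index k) $ Inr (wirtinger_index l)
      - wirtinger_sign k * H $ Inr (wirtinger_index k) $ Inr (wirtinger_index l))) / 4"
    by (subst partial_c_complex_combination)
       (simp_all add: real_analytic_complex_partial_r assms(1) H_def hessian_rr_nth algebra_simps
        add_divide_distrib diff_divide_distrib)
  finally show ?thesis .
qed

text \<open>Both real partials of f are real, so conjugation only flips the Wirtinger sign, which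
  exchanges the z- and zbar-operators.\<close>

lemma cnj_partial_c_of_real:
  assumes "real_analytic_complex f"
  shows "cnj (partial_c (Inl k) (\<lambda>w. complex_of_real (f w)) z) = partial_c (Inr k) (\<lambda>w. complex_of_real (f w)) z"
    and "cnj (partial_c (Inr k) (\<lambda>w. complex_of_real (f w)) z) = partial_c (Inl k) (\<lambda>w. complex_of_real (f w)) z"
  by (simp_all add: partial_c_of_real[OF assms] wirtinger_sign_def wirtinger_index_def)

text \<open>Conjugating the gradient exchanges its two halves, so the two Hessians differ by a swap
  of their block rows.\<close>

lemma hessian_R_cc_nth:
  assumes "real_analytic_complex f"
  shows "hessian_R_cc f z $ Inl k $ l = hessian_C_cc f z $ Inr k $ l"
    and "hessian_R_cc f z $ Inr k $ l = hessian_C_cc f z $ Inl k $ l"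
  by (simp_all add: hessian_R_cc_def hessian_C_cc_def jacobian_def row_gradient_def cnj_vec_def
      cnj_partial_c_of_real[OF assms])

lemma hessian_zz_nth: "hessian_zz f z $ k $ l = hessian_C_cc f z $ Inl k $ Inl l"
  by (simp add: hessian_zz_def hessian_C_cc_def jacobian_def row_gradient_def cnj_vec_def partial_c_def)

lemma hessian_zbarz_nth: "hessian_zbarz f z $ k $ l = hessian_C_cc f z $ Inl k $ Inr l"
  by (simp add: hessian_zbarz_def hessian_C_cc_def jacobian_def row_gradient_def cnj_vec_def partial_c_def)

section \<open>Block vectors, quadratic forms and multiplication by \<open>J_mat\<close>\<close>

lemma sum_UNIV_Plus:
  fixes h :: "'a::finite + 'b::finite \<Rightarrow> 'c::comm_monoid_add"
  shows "(\<Sum>k\<in>UNIV. h k) = (\<Sum>i\<in>UNIV. h (Inl i)) + (\<Sum>i\<in>UNIV. h (Inr i))"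
  unfolding UNIV_Plus_UNIV[symmetric] by (simp add: sum.Plus del: UNIV_Plus_UNIV)

lemma stack_nth [simp]: "stack u v $ Inl i = u $ i" "stack u v $ Inr i = v $ i"
  by (simp_all add: stack_def)

lemma block_matrix_nth [simp]:
  "block_matrix A B C D $ Inl i = stack (A $ i) (B $ i)"
  "block_matrix A B C D $ Inr i = stack (C $ i) (D $ i)"
  by (simp_all add: block_matrix_def)

text \<open>Collecting the four blocks in one double sum over index pairs lets two forms be compared
  summand by summand. The left and right vectors are independent because the Hermitian form
  conjugates only the left one.\<close>

lemma quadratic_form_stack:
  fixes H :: "'a::comm_semiring_1 ^ ('n::finite + 'n) ^ ('n + 'n)"
  shows "scalar_product (stack a b) (H *v stack c d) =
    (\<Sum>k\<in>UNIV. \<Sum>l\<in>UNIV. a $ k * H $ Inl k $ Inl l * c $ l + a $ k * H $ Inl k $ Inr l * d $ l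
      + b $ k * H $ Inr k $ Inl l * c $ l + b $ k * H $ Inr k $ Inr l * d $ l)"
  by (simp add: scalar_product_def matrix_vector_mult_def sum_UNIV_Plus sum.distrib
      sum_distrib_left algebra_simps)

lemma cnj_vec_nth [simp]: "cnj_vec v $ i = cnj (v $ i)"
  by (simp add: cnj_vec_def)

lemma cnj_vec_stack: "cnj_vec (stack u v) = stack (cnj_vec u) (cnj_vec v)"
  by (simp add: vec_eq_iff split_sum_all)

lemma matrix_mult_J_mat_nth:
  "(A ** J_mat) $ k $ Inl l = A $ k $ Inl l + A $ k $ Inr l"
  "(A ** J_mat) $ k $ Inr l = \<i> * (A $ k $ Inl l - A $ k $ Inr l)"
  by (simp_all add: J_mat_def matrix_matrix_mult_def sum_UNIV_Plus mat_def
      if_distrib[of "\<lambda>x. _ * x"] right_diff_distrib cong: if_cong)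

lemma conj_transpose_J_mat_mult_nth:
  "(conj_transpose J_mat ** A) $ Inl k $ l = A $ Inl k $ l + A $ Inr k $ l"
  "(conj_transpose J_mat ** A) $ Inr k $ l = \<i> * (A $ Inr k $ l - A $ Inl k $ l)"
  by (simp_all add: J_mat_def conj_transpose_def transpose_def map_matrix_def matrix_matrix_mult_def
      sum_UNIV_Plus mat_def if_distrib[of cnj] if_distrib[of "\<lambda>x. x * _"] right_diff_distrib
      cong: if_cong)

theorem mainTheorem1:
  fixes f :: "complex ^ 'n \<Rightarrow> real" and z :: "complex ^ 'n"
  assumes "real_analytic_complex f"
  shows "map_matrix complex_of_real (hessian_rr f z) = conj_transpose J_mat ** hessian_C_cc f z ** J_mat
    \<and> (\<forall>dx dy :: real ^ 'n.
        let dz = complex_vec dx dy; dr = stack dx dy; dc = stack dz (cnj_vec dz) in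
          complex_of_real (1/2 * scalar_product dr (hessian_rr f z *v dr))
            = 1/2 * scalar_product dc (hessian_R_cc f z *v dc)
        \<and> 1/2 * scalar_product dc (hessian_R_cc f z *v dc)
            = 1/2 * scalar_product (cnj_vec dc) (hessian_C_cc f z *v dc)
        \<and> 1/2 * scalar_product (cnj_vec dc) (hessian_C_cc f z *v dc)
            = complex_of_real (Re (scalar_product (cnj_vec dz) (hessian_zz f z *v dz)
                + scalar_product (cnj_vec dz) (hessian_zbarz f z *v cnj_vec dz))))"
proof (intro conjI allI)
  define S where "S = hessian_rr f z"
  have C: "hessian_C_cc f z $ Inl k $ Inl l =
        (S $ Inl k $ Inl l + \<i> * S $ Inr k $ Inl l - \<i> * S $ Inl k $ Inr l + S $ Inr k $ Inr l) / 4"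
      "hessian_C_cc f z $ Inl k $ Inr l =
        (S $ Inl k $ Inl l + \<i> * S $ Inr k $ Inl l + \<i> * S $ Inl k $ Inr l - S $ Inr k $ Inr l) / 4"
      "hessian_C_cc f z $ Inr k $ Inl l =
        (S $ Inl k $ Inl l - \<i> * S $ Inr k $ Inl l - \<i> * S $ Inl k $ Inr l - S $ Inr k $ Inr l) / 4"
      "hessian_C_cc f z $ Inr k $ Inr l =
        (S $ Inl k $ Inl l - \<i> * S $ Inr k $ Inl l + \<i> * S $ Inl k $ Inr l + S $ Inr k $ Inr l) / 4"
    for k l
    by (simp_all add: hessian_C_cc_nth[OF assms] S_def wirtinger_sign_def wirtinger_index_def algebra_simps)
  show "map_matrix complex_of_real (hessian_rr f z) = conj_transpose J_mat ** hessian_C_cc f z ** J_mat"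
    unfolding S_def[symmetric] vec_eq_iff split_sum_all
    by (simp add: map_matrix_def matrix_mult_J_mat_nth conj_transpose_J_mat_mult_nth C field_simps)
  fix dx dy :: "real ^ 'n"
  define dz where "dz = complex_vec dx dy"
  have dz: "dz $ k = Complex (dx $ k) (dy $ k)" for k
    by (simp add: dz_def complex_vec_def)
  define dc where "dc = stack dz (cnj_vec dz)"
  have "cnj_vec (cnj_vec dz) = dz"
    by (simp add: vec_eq_iff)
  then have cnj_dc: "cnj_vec dc = stack (cnj_vec dz) dz"
    by (simp add: dc_def cnj_vec_stack)
  \<comment> \<open>The passage between \<open>dc\<close> and the real increments only mixes the two
    halves at the same index, so equality already holds for each pair of indices.\<close>
  have 1: "scalar_product (cnj_vec dc) (hessian_C_cc f z *v dc) = scalar_product (stack dx dy) (S *v stack dx dy)"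
    unfolding cnj_dc unfolding dc_def quadratic_form_stack of_real_sum
    by (intro sum.cong refl) (simp add: C dz complex_eq_iff field_simps)
  \<comment> \<open>The swap of block rows matches the swap of halves from \<open>dc\<close> to
    \<open>cnj_vec dc\<close>, so only the order of addition differs.\<close>
  have 2: "scalar_product dc (hessian_R_cc f z *v dc) = scalar_product (cnj_vec dc) (hessian_C_cc f z *v dc)"
    unfolding cnj_dc unfolding dc_def quadratic_form_stack
    by (intro sum.cong refl) (simp add: hessian_R_cc_nth[OF assms] add_ac)
  \<comment> \<open>In the Hermitian form the lower block row contributes the conjugate of the upper
    one. The whole is twice the real part of the upper row, which cancels the factor 1/2.\<close>
  have 3: "1/2 * scalar_product (stack dx dy) (S *v stack dx dy)
      = Re (scalar_product (cnj_vec dz) (hessian_zz f z *v dz)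
                + scalar_product (cnj_vec dz) (hessian_zbarz f z *v cnj_vec dz))"
    unfolding quadratic_form_stack
    unfolding scalar_product_def matrix_vector_mult_def plus_complex.simps Re_sum vec_lambda_beta
      sum_distrib_left sum.distrib[symmetric]
    by (intro sum.cong refl) (simp add: C hessian_zz_nth hessian_zbarz_nth dz field_simps)
  show "let dz = complex_vec dx dy; dr = stack dx dy; dc = stack dz (cnj_vec dz) in
          complex_of_real (1/2 * scalar_product dr (hessian_rr f z *v dr))
            = 1/2 * scalar_product dc (hessian_R_cc f z *v dc)
        \<and> 1/2 * scalar_product dc (hessian_R_cc f z *v dc)
            = 1/2 * scalar_product (cnj_vec dc) (hessian_C_cc f z *v dc)
        \<and> 1/2 * scalar_product (cnj_vec dc) (hessian_C_cc f z *v dc)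
            = complex_of_real (Re (scalar_product (cnj_vec dz) (hessian_zz f z *v dz)
                + scalar_product (cnj_vec dz) (hessian_zbarz f z *v cnj_vec dz)))"
    unfolding Let_def dz_def[symmetric] dc_def[symmetric] S_def[symmetric] 3[symmetric] 2 1
    by simp
qed

end
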